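(* Let $d\ge 1$, let $H^d=[0,1]^d$, let $i\in\{1,\dots,d\}$, and let $G:H^d\to\mathbb{R}$ be a differentiable, square integrable function with variance $V>0$ and with $\partial G/\partial x_i\in L_2(H^d)$. Define the derivative based global sensitivity measure $$\varsigma_i=\frac12\int_{H^d}x_i(1-x_i)\left(\frac{\partial G(\mathbf{x})}{\partial x_i}\right)^2d\mathbf{x}.$$ Then the total Sobol' sensitivity index $S_i^{\mathrm{tot}}$ of $G$ with respect to $x_i$ satisfies $$S_i^{\mathrm{tot}}\le\frac{\varsigma_i}{V}.$$
   Context: The inputs are independent and uniformly distributed on $[0,1]$, so all integrals over $H^d=[0,1]^d$ are with respect to Lebesgue measure. The variance of $G$ is $V=\int_{H^d}G(\mathbf{x})^2\,d\mathbf{x}-\left(\int_{H^d}G(\mathbf{x})\,d\mathbf{x}\right)^2$. The ANOVA decomposition of a square integrable $G$ is the unique expansion $G(\mathbf{x})=g_0+\sum_i g_i(x_i)+\sum_{i<j}g_{ij}(x_i,x_j)+\dots+g_{12\dots d}(x_1,\dots,x_d)$ such that $\int_0^1 g_{i_1\dots i_s}\,dx_{i_k}=0$ for all $1\le k\le s$ and all $1\le i_1<\dots<i_s\le d$. The partial variances are $V_{i_1\dots i_s}=\int g_{i_1\dots i_s}^2\,dx_{i_1}\cdots dx_{i_s}$. The total variance $V_i^{\mathrm{tot}}$ of $x_i$ is the sum of all partial variances $V_{i_1\dots i_s}$ with $i\in\{i_1,\dots,i_s\}$, and the total Sobol' sensitivity index is $S_i^{\mathrm{tot}}=V_i^{\mathrm{tot}}/V$.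 Equivalently, $V_i^{\mathrm{tot}}=\int_{H^d}u_i(\mathbf{x})^2\,d\mathbf{x}$, where $u_i(\mathbf{x})=G(\mathbf{x})-\int_0^1 G(\mathbf{x})\,dx_i$ is the sum of all terms of the ANOVA decomposition that depend on $x_i$. *)

theory Defs
  imports "HOL-Analysis.Analysis"
begin

abbreviation unit_cube :: "(real ^ 'n) set" where
  "unit_cube \<equiv> cbox 0 1"

text \<open>Functions on the cube are modelled by total functions; only their values on the cube are
  ever used.\<close>

definition square_integrable_cube :: "(real ^ 'n \<Rightarrow> real) \<Rightarrow> bool" where
  "square_integrable_cube f \<longleftrightarrow>
     set_borel_measurable lborel unit_cube f \<and>
     set_integrable lborel unit_cube (\<lambda>x. (f x)\<^sup>2)"

definition cube_variance :: "(real ^ 'n \<Rightarrow> real) \<Rightarrow> real" where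
  "cube_variance f =
     (LINT x:unit_cube|lborel. (f x)\<^sup>2) - (LINT x:unit_cube|lborel. f x)\<^sup>2"

definition set_coord :: "real ^ 'n \<Rightarrow> 'n \<Rightarrow> real \<Rightarrow> real ^ 'n" where
  "set_coord x j t = (\<chi> k. if k = j then t else x $ k)"

text \<open>The derivative is one-sided on the faces where the \<open>i\<close>-th coordinate is 0 or 1.\<close>

definition partial_derivative :: "'n \<Rightarrow> (real ^ 'n \<Rightarrow> real) \<Rightarrow> real ^ 'n \<Rightarrow> real" where
  "partial_derivative i f x =
     vector_derivative (\<lambda>t. f (set_coord x i t)) (at (x $ i) within {0..1})"

text \<open>The components of an ANOVA decomposition are indexed by the set of variables on which they
  depend, the constant term being the component at the empty set. As usual for square integrable
  functions, the identities are required almost everywhere.\<close>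

definition anova_decomposition ::
    "(real ^ 'n \<Rightarrow> real) \<Rightarrow> ('n set \<Rightarrow> real ^ 'n \<Rightarrow> real) \<Rightarrow> bool" where
  "anova_decomposition f g \<longleftrightarrow>
     (\<forall>u. square_integrable_cube (g u)) \<and>
     (\<forall>u. \<forall>x\<in>unit_cube. \<forall>y\<in>unit_cube. (\<forall>j\<in>u. x $ j = y $ j) \<longrightarrow> g u x = g u y) \<and>
     (\<forall>u. \<forall>j\<in>u. AE x in lborel. x \<in> unit_cube \<longrightarrow>
        (LINT t:{0..1}|lborel. g u (set_coord x j t)) = 0) \<and>
     (AE x in lborel. x \<in> unit_cube \<longrightarrow> f x = (\<Sum>u\<in>UNIV. g u x))"

text \<open>The components are unique up to null sets, so the choice does not affect the variances
  below.\<close>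

definition anova_component ::
    "(real ^ 'n \<Rightarrow> real) \<Rightarrow> 'n set \<Rightarrow> real ^ 'n \<Rightarrow> real" where
  "anova_component f = (SOME g. anova_decomposition f g)"

text \<open>Integrating over the whole cube is the same as integrating over the variables in \<open>u\<close>,
  because the component at \<open>u\<close> does not depend on the others.\<close>

definition partial_variance :: "(real ^ 'n \<Rightarrow> real) \<Rightarrow> 'n set \<Rightarrow> real" where
  "partial_variance f u = (LINT x:unit_cube|lborel. (anova_component f u x)\<^sup>2)"

definition total_variance :: "'n \<Rightarrow> (real ^ 'n \<Rightarrow> real) \<Rightarrow> real" where
  "total_variance i f = (\<Sum>u\<in>{u. i \<in> u}. partial_variance f u)"

definition total_sobol_index :: "'n \<Rightarrow> (real ^ 'n \<Rightarrow> real) \<Rightarrow> real" where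
  "total_sobol_index i f = total_variance i f / cube_variance f"

definition dgsm :: "'n \<Rightarrow> (real ^ 'n \<Rightarrow> real) \<Rightarrow> real" where
  "dgsm i f =
     1 / 2 * (LINT x:unit_cube|lborel. x $ i * (1 - x $ i) * (partial_derivative i f x)\<^sup>2)"

end

theory Submission
  imports Defs
begin

text \<open>Let \<open>w\<close> be the sum of the ANOVA components that depend on \<open>x\<^sub>i\<close>. The components are pairwise
  orthogonal, because resampling one coordinate of a uniform point of the cube leaves its distribution
  unchanged, so the total variance is \<open>\<integral> w\<^sup>2\<close>. On almost every line parallel to the \<open>i\<close>-th axis, \<open>w\<close> is
  \<open>G\<close> minus its mean, and the claim reduces to the one-dimensional inequality
  \<open>2 Var f \<le> \<integral> s (1 - s) f'(s)\<^sup>2 ds\<close>. For the latter, \<open>2 Var f = \<integral>\<integral> (f x - f y)\<^sup>2 dx dy\<close>, the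
  Cauchy-Schwarz inequality gives \<open>(f x - f y)\<^sup>2 \<le> \<bar>x - y\<bar> \<integral> f'(s)\<^sup>2 ds\<close> with \<open>s\<close> ranging between \<open>x\<close>
  and \<open>y\<close>, and exchanging the integrals leaves exactly the weight \<open>s (1 - s)\<close>.\<close>

subsection \<open>Resampling one coordinate\<close>

text \<open>Restricting the measure, rather than carrying indicators along, makes the cube and the
  interval finite measure spaces, so that Fubini applies to their products.\<close>

abbreviation cube_measure :: "(real ^ 'n) measure" where
  "cube_measure \<equiv> restrict_space lborel unit_cube"

abbreviation interval_lebesgue :: "real measure" where
  "interval_lebesgue \<equiv> restrict_space lborel {0..1}"

lemma finite_measure_interval_lebesgue: "finite_measure interval_lebesgue"
  by (rule finite_measureI) (simp add: space_restrict_space emeasure_restrict_space)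

lemma finite_measure_cube_measure: "finite_measure cube_measure"
  by (rule finite_measureI)
     (simp add: space_restrict_space emeasure_restrict_space emeasure_lborel_cbox_eq)

interpretation I: finite_measure interval_lebesgue
  by (rule finite_measure_interval_lebesgue)

interpretation C: finite_measure cube_measure
  by (rule finite_measure_cube_measure)

interpretation CI: pair_sigma_finite cube_measure interval_lebesgue ..

interpretation II: pair_sigma_finite interval_lebesgue interval_lebesgue ..

lemma set_coord_nth [simp]: "set_coord x j t $ k = (if k = j then t else x $ k)"
  by (simp add: set_coord_def)

lemma set_coord_set_coord [simp]: "set_coord (set_coord x j s) j t = set_coord x j t"
  by (simp add: vec_eq_iff)

lemma set_coord_commute:
  "j \<noteq> k \<Longrightarrow> set_coord (set_coord x j s) k t = set_coord (set_coord x k t) j s"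
  by (simp add: vec_eq_iff)

lemma set_coord_in_cube [simp]:
  "x \<in> unit_cube \<Longrightarrow> 0 \<le> t \<Longrightarrow> t \<le> 1 \<Longrightarrow> set_coord x j t \<in> unit_cube"
  by (simp add: mem_box_cart)

lemma continuous_on_set_coord [continuous_intros]:
  "continuous_on S f \<Longrightarrow> continuous_on S g \<Longrightarrow> continuous_on S (\<lambda>z. set_coord (f z) j (g z))"
  unfolding set_coord_def
  by (intro continuous_on_vec_lambda, rename_tac k, case_tac "k = j")
     (auto intro: continuous_on_component)

lemma borel_measurable_set_coord [measurable]:
  "(\<lambda>(x, t). set_coord x j t) \<in> borel_measurable (borel \<Otimes>\<^sub>M borel)"
  by (auto simp: borel_prod split_beta' intro!: borel_measurable_continuous_onI continuous_intros)

text \<open>The two measures are left generic because the map is used both on an open slab paired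
  with the whole line and on the cube paired with the interval.\<close>

lemma measurable_set_coord_pair:
  assumes "(\<lambda>x. x) \<in> borel_measurable M" "(\<lambda>t. t) \<in> borel_measurable N"
  shows "(\<lambda>(x, t). set_coord x j t) \<in> borel_measurable (M \<Otimes>\<^sub>M N)"
proof -
  have "(\<lambda>z. (fst z, snd z)) \<in> M \<Otimes>\<^sub>M N \<rightarrow>\<^sub>M borel \<Otimes>\<^sub>M borel"
    using measurable_compose[OF measurable_fst assms(1)] measurable_compose[OF measurable_snd assms(2)]
    by (rule measurable_Pair)
  from measurable_compose[OF this borel_measurable_set_coord[of j]]
  show ?thesis by (simp add: split_beta')
qed

lemma measurable_ident_restrict_lborel: "(\<lambda>x. x) \<in> borel_measurable (restrict_space lborel S)"
  by (intro measurable_restrict_space1) simp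

lemma measurable_set_coord_cube [measurable]:
  "(\<lambda>(x, t). set_coord x j t) \<in> cube_measure \<Otimes>\<^sub>M interval_lebesgue \<rightarrow>\<^sub>M cube_measure"
proof (rule measurable_restrict_space2)
  show "(\<lambda>(x, t). set_coord x j t) \<in> space (cube_measure \<Otimes>\<^sub>M interval_lebesgue) \<rightarrow> unit_cube"
    by (auto simp: space_pair_measure space_restrict_space)
  show "(\<lambda>(x, t). set_coord x j t) \<in> cube_measure \<Otimes>\<^sub>M interval_lebesgue \<rightarrow>\<^sub>M lborel"
    using measurable_set_coord_pair[OF measurable_ident_restrict_lborel measurable_ident_restrict_lborel]
    by simp
qed

section \<open>Invariance of the uniform distribution under resampling\<close>

lemma emeasure_lborel_box_cart:
  fixes l u :: "real ^ 'n"
  assumes "\<And>k. l $ k \<le> u $ k"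
  shows "emeasure lborel (box l u) = (\<Prod>k\<in>UNIV. ennreal (u $ k - l $ k))"
proof -
  have "emeasure lborel (box l u) = ennreal (\<Prod>b\<in>Basis. (u - l) \<bullet> b)"
    using assms by (subst emeasure_lborel_box) (auto simp: Basis_vec_def cart_eq_inner_axis[symmetric])
  also have "(\<Prod>b\<in>Basis. (u - l) \<bullet> b) = (\<Prod>k\<in>UNIV. u $ k - l $ k)"
    by (simp add: Basis_vec_def cart_eq_inner_axis axis_eq_axis prod.UNION_disjoint inner_diff_left)
  finally show ?thesis
    using assms by (simp add: prod_ennreal)
qed

text \<open>The slab is open so that its intersection with a box is again a box.\<close>

lemma lborel_eq_distr_set_coord:
  fixes j :: "'n::finite"
  defines "S \<equiv> {x :: real ^ 'n. 0 < x $ j \<and> x $ j < 1}"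
  shows "lborel = distr (restrict_space lborel S \<Otimes>\<^sub>M lborel) borel (\<lambda>(x, t). set_coord x j t)"
proof -
  have S [simp]: "S \<in> sets borel"
    unfolding S_def by measurable
  have m: "(\<lambda>(x, t). set_coord x j t) \<in> restrict_space lborel S \<Otimes>\<^sub>M lborel \<rightarrow>\<^sub>M borel"
    by (intro measurable_set_coord_pair measurable_ident_restrict_lborel) simp
  show ?thesis
  proof (rule lborel_eqI)
    fix l u :: "real ^ 'n"
    assume lu: "\<And>b. b \<in> Basis \<Longrightarrow> l \<bullet> b \<le> u \<bullet> b"
    have le: "l $ k \<le> u $ k" for k
      using lu[of "axis k 1"] by (simp add: cart_eq_inner_axis)
    \<comment> \<open>The \<open>j\<close>-th side of the box is replaced by (0,1). The preimage of
      \<open>box l u\<close> in the slab is then \<open>?B\<close> times the original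
      \<open>j\<close>-th side, and the new side, having length 1, does not change the
      volume.\<close>
    let ?B = "box (set_coord l j 0) (set_coord u j 1)"
    have BS: "?B \<subseteq> S"
    proof
      fix x assume "x \<in> ?B"
      then have "set_coord l j 0 $ j < x $ j \<and> x $ j < set_coord u j 1 $ j"
        unfolding mem_box_cart by blast
      then show "x \<in> S" by (simp add: S_def)
    qed
    have "emeasure (distr (restrict_space lborel S \<Otimes>\<^sub>M lborel) borel (\<lambda>(x, t). set_coord x j t)) (box l u)
        = emeasure (restrict_space lborel S \<Otimes>\<^sub>M lborel) (?B \<times> {l $ j<..<u $ j})"
      using m by (subst emeasure_distr)
        (auto simp: mem_box_cart S_def space_pair_measure space_restrict_space split: if_splits intro!: arg_cong2[where f=emeasure])
    also have "\<dots> = emeasure lborel ?B * ennreal (u $ j - l $ j)"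
      using BS le by (subst lborel.emeasure_pair_measure_Times)
        (auto simp: sets_restrict_space_iff emeasure_restrict_space)
    also have "emeasure lborel ?B = (\<Prod>k\<in>UNIV - {j}. ennreal (u $ k - l $ k))"
      using le by (subst emeasure_lborel_box_cart) (auto simp: prod.remove[of UNIV j] intro!: prod.cong)
    also have "\<dots> * ennreal (u $ j - l $ j) = emeasure lborel (box l u)"
      using le by (subst emeasure_lborel_box_cart) (auto simp: prod.remove[of UNIV j] mult.commute)
    also have "\<dots> = ennreal (\<Prod>b\<in>Basis. (u - l) \<bullet> b)"
      using lu by simp
    finally show "emeasure (distr (restrict_space lborel S \<Otimes>\<^sub>M lborel) borel (\<lambda>(x, t). set_coord x j t)) (box l u) =
      ennreal (\<Prod>b\<in>Basis. (u - l) \<bullet> b)" .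
  qed simp
qed

text \<open>A coordinate hyperplane is a null set. This allows the faces of the cube to be ignored
  when the open slab is exchanged for the closed cube.\<close>

lemma AE_lborel_nth_neq:
  fixes j :: "'n::finite"
  shows "AE x in lborel. (x :: real ^ 'n) $ j \<noteq> a"
proof -
  have "(axis j 1 :: real ^ 'n) \<in> Basis"
    by (simp add: axis_in_Basis_iff)
  then have "{x :: real ^ 'n. x \<bullet> axis j 1 = a} \<in> null_sets lebesgue"
    unfolding negligible_iff_null_sets[symmetric] by (rule negligible_standard_hyperplane)
  moreover have "{x :: real ^ 'n. x \<bullet> axis j 1 = a} \<in> sets borel"
    by measurable
  ultimately have "{x :: real ^ 'n. x $ j = a} \<in> null_sets lborel"
    by (simp add: null_sets_completion_iff cart_eq_inner_axis)
  from AE_not_in[OF this] show ?thesis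
    by simp
qed

text \<open>Follows from the slab version by integrating the indicator of a subset of the cube. It
  replaces a splitting of the space into a line and its complement: every later integration along
  lines in direction \<open>j\<close> goes through this identity.\<close>

lemma cube_measure_eq_distr_set_coord:
  fixes j :: "'n::finite"
  shows "(cube_measure :: (real ^ 'n) measure)
    = distr (cube_measure \<Otimes>\<^sub>M interval_lebesgue) cube_measure (\<lambda>(x, t). set_coord x j t)"
proof (rule measure_eqI)
  let ?\<phi> = "\<lambda>(x :: real ^ 'n, t). set_coord x j t"
  define S where "S = {x :: real ^ 'n. 0 < x $ j \<and> x $ j < 1}"
  have S [simp]: "S \<in> sets borel"
    unfolding S_def by measurable
  fix A :: "(real ^ 'n) set" assume "A \<in> sets cube_measure"
  then have A: "A \<in> sets borel" "A \<subseteq> unit_cube"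
    by (auto simp: sets_restrict_space_iff)
  have ind: "(\<lambda>z. indicator A (?\<phi> z) :: ennreal) \<in> borel_measurable (restrict_space lborel X \<Otimes>\<^sub>M N)"
    if "(\<lambda>t. t) \<in> borel_measurable N" for X N
    using measurable_compose[OF measurable_set_coord_pair[OF measurable_ident_restrict_lborel that]
        borel_measurable_indicator[OF A(1)]]
    by (simp add: split_beta')
  have "emeasure cube_measure A = emeasure lborel A"
    using A by (simp add: emeasure_restrict_space)
  also have "\<dots> = (\<integral>\<^sup>+x. indicator A x \<partial>lborel)"
    using A by simp
  also have "\<dots> = (\<integral>\<^sup>+x. indicator A x \<partial>distr (restrict_space lborel S \<Otimes>\<^sub>M lborel) borel ?\<phi>)"
    by (subst lborel_eq_distr_set_coord[of j]) (simp add: S_def)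
  also have "\<dots> = (\<integral>\<^sup>+z. indicator A (?\<phi> z) \<partial>(restrict_space lborel S \<Otimes>\<^sub>M lborel))"
    using A(1) by (subst nn_integral_distr)
      (auto intro!: measurable_set_coord_pair measurable_ident_restrict_lborel)
  also have "\<dots> = (\<integral>\<^sup>+x. \<integral>\<^sup>+t. indicator A (set_coord x j t) \<partial>lborel \<partial>restrict_space lborel S)"
    by (subst lborel.nn_integral_fst[symmetric]) (auto intro!: ind)
  also have "\<dots> = (\<integral>\<^sup>+x. (\<integral>\<^sup>+t. indicator A (set_coord x j t) \<partial>lborel) * indicator S x \<partial>lborel)"
    by (simp add: nn_integral_restrict_space)
  also have "\<dots> = (\<integral>\<^sup>+x. (\<integral>\<^sup>+t. indicator A (set_coord x j t) * indicator {0..1} t \<partial>lborel) * indicator unit_cube x \<partial>lborel)"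
  \<comment> \<open>If \<open>set_coord x j t\<close> lies in \<open>A\<close>, hence in the cube,
    then \<open>t\<close> lies in the unit interval and so do all coordinates of \<open>x\<close>
    other than the \<open>j\<close>-th. Off the faces where that coordinate is 0 or 1, lying in the
    slab therefore amounts to lying in the cube.\<close>
  proof (rule nn_integral_cong_AE)
    show "AE x in lborel. (\<integral>\<^sup>+t. indicator A (set_coord x j t) \<partial>lborel) * indicator S x
      = (\<integral>\<^sup>+t. indicator A (set_coord x j t) * indicator {0..1} t \<partial>lborel) * indicator unit_cube x"
      using AE_lborel_nth_neq[of j 0] AE_lborel_nth_neq[of j 1]
    proof eventually_elim
      case (elim x)
      have in_cube: "0 \<le> t \<and> t \<le> 1 \<and> (0 < x $ j \<and> x $ j < 1 \<longrightarrow> x \<in> unit_cube)" if "set_coord x j t \<in> A" for t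
      proof -
        have c: "0 \<le> set_coord x j t $ k \<and> set_coord x j t $ k \<le> 1" for k
        proof -
          have "set_coord x j t \<in> unit_cube" using that A(2) by blast
          then show ?thesis unfolding mem_box_cart by simp
        qed
        have "0 \<le> x $ k \<and> x $ k \<le> 1" if "0 < x $ j \<and> x $ j < 1" for k
          using c[of k] that by (cases "k = j") auto
        then show ?thesis
          using c[of j] by (auto simp: mem_box_cart)
      qed
      show ?case
      proof (cases "x \<in> S")
        case True
        show ?thesis
        proof (cases "x \<in> unit_cube")
          case True
          with \<open>x \<in> S\<close> in_cube show ?thesis
            by (auto simp: indicator_def intro!: nn_integral_cong)
        next
          case False
          with \<open>x \<in> S\<close> in_cube have "set_coord x j t \<notin> A" for t
            by (auto simp: S_def)
          then show ?thesis using False by simp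
        qed
      next
        case False
        have "0 < x $ j \<and> x $ j < 1" if "x \<in> unit_cube"
        proof -
          have "0 \<le> x $ j \<and> x $ j \<le> 1" using that by (auto simp: mem_box_cart)
          with elim show ?thesis by auto
        qed
        with False have "x \<notin> unit_cube" by (auto simp: S_def)
        with False show ?thesis by simp
      qed
    qed
  qed
  also have "\<dots> = (\<integral>\<^sup>+x. \<integral>\<^sup>+t. indicator A (set_coord x j t) \<partial>interval_lebesgue \<partial>cube_measure)"
    by (simp add: nn_integral_restrict_space)
  also have "\<dots> = (\<integral>\<^sup>+z. indicator A (?\<phi> z) \<partial>(cube_measure \<Otimes>\<^sub>M interval_lebesgue))"
    by (subst I.nn_integral_fst[symmetric]) (auto intro!: ind measurable_ident_restrict_lborel)
  also have "\<dots> = (\<integral>\<^sup>+x. indicator A x \<partial>distr (cube_measure \<Otimes>\<^sub>M interval_lebesgue) cube_measure ?\<phi>)"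
    using \<open>A \<in> sets cube_measure\<close> by (subst nn_integral_distr) auto
  also have "\<dots> = emeasure (distr (cube_measure \<Otimes>\<^sub>M interval_lebesgue) cube_measure ?\<phi>) A"
    using \<open>A \<in> sets cube_measure\<close> by simp
  finally show "emeasure cube_measure A = emeasure (distr (cube_measure \<Otimes>\<^sub>M interval_lebesgue) cube_measure ?\<phi>) A" .
qed simp

subsection \<open>The weighted Poincare inequality on the unit interval\<close>

text \<open>The pairs \<open>(x, y)\<close> whose segment contains \<open>s\<close>, weighted by its length, have total mass
  \<open>s (1 - s)\<close>: this is where the weight of the sensitivity measure comes from.\<close>

lemma nn_integral_dist_separated_by:
  assumes s: "0 \<le> s" "s \<le> (1 :: real)"
  shows "(\<integral>\<^sup>+x. \<integral>\<^sup>+y. (if min x y \<le> s \<and> s \<le> max x y then ennreal \<bar>x - y\<bar> else 0)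
            \<partial>interval_lebesgue \<partial>interval_lebesgue) = ennreal (s * (1 - s))"
proof -
  \<comment> \<open>The inner integral over \<open>y\<close>: a point \<open>x < s\<close> is
    separated by \<open>s\<close> from the \<open>y\<close> in [s,1], a point \<open>x > s\<close>
    from those in [0,s]. At \<open>x = s\<close> every \<open>y\<close> counts and the formula may
    fail, but this is a single point.\<close>
  define h where "h x = (if x < s then (1 - s\<^sup>2) / 2 - x * (1 - s) else x * s - s\<^sup>2 / 2)" for x
  let ?k = "\<lambda>x y. if min x y \<le> s \<and> s \<le> max x y then ennreal \<bar>x - y\<bar> else 0"
  have inner: "(\<integral>\<^sup>+y. ?k x y \<partial>interval_lebesgue) = ennreal (h x)" if x: "0 \<le> x" "x \<le> 1" "x \<noteq> s" for x
  proof (cases "x < s")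
    case True
    have "(\<integral>\<^sup>+y. ?k x y \<partial>interval_lebesgue) = (\<integral>\<^sup>+y. ennreal (y - x) * indicator {s..1} y \<partial>lborel)"
      using True x s by (auto simp: nn_integral_restrict_space indicator_def intro!: nn_integral_cong)
    also have "\<dots> = ennreal ((1\<^sup>2 / 2 - x * 1) - (s\<^sup>2 / 2 - x * s))"
      using True x s by (intro nn_integral_FTC_Icc) (auto intro!: derivative_eq_intros)
    also have "(1\<^sup>2 / 2 - x * 1) - (s\<^sup>2 / 2 - x * s) = h x"
      using True by (simp add: h_def field_simps)
    finally show ?thesis .
  next
    case False
    have "(\<integral>\<^sup>+y. ?k x y \<partial>interval_lebesgue) = (\<integral>\<^sup>+y. ennreal (x - y) * indicator {0..s} y \<partial>lborel)"
      using False x s by (auto simp: nn_integral_restrict_space indicator_def intro!: nn_integral_cong)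
    also have "\<dots> = ennreal ((x * s - s\<^sup>2 / 2) - (x * 0 - 0\<^sup>2 / 2))"
      using False x s by (intro nn_integral_FTC_Icc) (auto intro!: derivative_eq_intros)
    also have "(x * s - s\<^sup>2 / 2) - (x * 0 - 0\<^sup>2 / 2) = h x"
      using False by (simp add: h_def)
    finally show ?thesis .
  qed
  have "(\<integral>\<^sup>+x. \<integral>\<^sup>+y. ?k x y \<partial>interval_lebesgue \<partial>interval_lebesgue)
      = (\<integral>\<^sup>+x. ennreal (h x) \<partial>interval_lebesgue)"
    using AE_lborel_singleton[of s]
    by (intro nn_integral_cong_AE) (auto simp: AE_restrict_space_iff inner elim!: eventually_mono)
  also have "\<dots> = (\<integral>\<^sup>+x. ennreal ((1 - s\<^sup>2) / 2 - x * (1 - s)) * indicator {0..s} x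
      + ennreal (x * s - s\<^sup>2 / 2) * indicator {s..1} x \<partial>lborel)"
  proof -
    have "AE x in lborel. ennreal (h x) * indicator {0..1} x
      = ennreal ((1 - s\<^sup>2) / 2 - x * (1 - s)) * indicator {0..s} x
        + ennreal (x * s - s\<^sup>2 / 2) * indicator {s..1} x"
      using AE_lborel_singleton[of s]
      by eventually_elim (use s in \<open>auto simp: h_def indicator_def\<close>)
    then show ?thesis
      by (subst nn_integral_restrict_space) (auto intro: nn_integral_cong_AE)
  qed
  also have "\<dots> = (\<integral>\<^sup>+x. ennreal ((1 - s\<^sup>2) / 2 - x * (1 - s)) * indicator {0..s} x \<partial>lborel)
      + (\<integral>\<^sup>+x. ennreal (x * s - s\<^sup>2 / 2) * indicator {s..1} x \<partial>lborel)"
    by (rule nn_integral_add) measurable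
  also have "(\<integral>\<^sup>+x. ennreal ((1 - s\<^sup>2) / 2 - x * (1 - s)) * indicator {0..s} x \<partial>lborel)
      = ennreal (((1 - s\<^sup>2) / 2 * s - s\<^sup>2 / 2 * (1 - s)) - ((1 - s\<^sup>2) / 2 * 0 - 0\<^sup>2 / 2 * (1 - s)))"
  proof (rule nn_integral_FTC_Icc)
    fix x assume x: "x \<in> {0..s}"
    show "0 \<le> (1 - s\<^sup>2) / 2 - x * (1 - s)"
    proof -
      have "x * (1 - s) \<le> s * (1 - s)" using x s by (intro mult_right_mono) auto
      \<comment> \<open>The function is nonincreasing in \<open>x\<close>, and its value at
        \<open>x = s\<close> is \<open>(1 - s)\<^sup>2 / 2\<close>.\<close>
      moreover have "0 \<le> (1 - s)\<^sup>2" by simp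
      ultimately show ?thesis by (simp add: power2_eq_square field_simps)
    qed
  qed (use s in \<open>auto intro!: derivative_eq_intros\<close>)
  also have "(\<integral>\<^sup>+x. ennreal (x * s - s\<^sup>2 / 2) * indicator {s..1} x \<partial>lborel)
      = ennreal ((1\<^sup>2 / 2 * s - s\<^sup>2 / 2 * 1) - (s\<^sup>2 / 2 * s - s\<^sup>2 / 2 * s))"
  proof (rule nn_integral_FTC_Icc)
    fix x assume x: "x \<in> {s..1}"
    show "0 \<le> x * s - s\<^sup>2 / 2"
    proof -
      have "s * s \<le> x * s" using x s by (intro mult_right_mono) auto
      then show ?thesis
        using zero_le_square[of s] unfolding power2_eq_square by linarith
    qed
  qed (use s in \<open>auto intro!: derivative_eq_intros\<close>)
  \<comment> \<open>The pairs with \<open>x\<close> to the left of \<open>s\<close> and those with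
    \<open>x\<close> to its right contribute equally, half of the weight each.\<close>
  also have "((1 - s\<^sup>2) / 2 * s - s\<^sup>2 / 2 * (1 - s)) - ((1 - s\<^sup>2) / 2 * 0 - 0\<^sup>2 / 2 * (1 - s)) = s * (1 - s) / 2"
    by (simp add: power2_eq_square field_simps)
  also have "(1\<^sup>2 / 2 * s - s\<^sup>2 / 2 * 1) - (s\<^sup>2 / 2 * s - s\<^sup>2 / 2 * s) = s * (1 - s) / 2"
    by (simp add: power2_eq_square field_simps)
  also have "ennreal (s * (1 - s) / 2) + ennreal (s * (1 - s) / 2) = ennreal (s * (1 - s))"
    using s by (simp flip: ennreal_plus)
  finally show ?thesis .
qed

text \<open>Cauchy-Schwarz for the increment written as the integral of \<open>f'\<close> over
  [a,b], the factor \<open>b - a\<close> being the integral of the square of 1.\<close>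

lemma increment_square_le:
  fixes f f' :: "real \<Rightarrow> real"
  assumes deriv: "\<And>t. t \<in> {0..1} \<Longrightarrow> (f has_vector_derivative f' t) (at t within {0..1})"
    and meas: "f' \<in> borel_measurable interval_lebesgue"
    and int: "integrable interval_lebesgue (\<lambda>t. (f' t)\<^sup>2)"
    and ab: "0 \<le> a" "a \<le> b" "b \<le> 1"
  shows "(f b - f a)\<^sup>2 \<le> (b - a) * (\<integral>t. indicator {a..b} t * (f' t)\<^sup>2 \<partial>interval_lebesgue)"
proof -
  have int1: "integrable interval_lebesgue f'"
    using meas int by (rule I.square_integrable_imp_integrable)
  have intab: "set_integrable lborel {a..b} f'"
  proof -
    have "set_integrable lborel {0..1} f'"
      using int1 unfolding set_integrable_def by (subst (asm) integrable_restrict_space) auto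
    then show ?thesis
      by (rule set_integrable_subset) (use ab in auto)
  qed
  \<comment> \<open>The gauge integral recovers a function from any derivative, even a discontinuous
    one; \<open>intab\<close> then identifies it with the Lebesgue integral.\<close>
  have "(f' has_integral (f b - f a)) {a..b}"
    using ab by (intro fundamental_theorem_of_calculus)
      (auto intro!: has_vector_derivative_within_subset[OF deriv])
  then have ftc: "(LINT t:{a..b}|lborel. f' t) = f b - f a"
    using set_borel_integral_eq_integral(2)[OF intab] by (simp add: integral_unique)
  have ftc': "(\<integral>t. indicator {a..b} t * f' t \<partial>interval_lebesgue) = f b - f a"
  proof -
    have "(\<integral>t. indicator {a..b} t * f' t \<partial>interval_lebesgue) = (\<integral>t. indicator {0..1} t * (indicator {a..b} t * f' t) \<partial>lborel)"
      by (subst integral_restrict_space) auto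
    also have "\<dots> = (LINT t:{a..b}|lborel. f' t)"
      unfolding set_lebesgue_integral_def using ab
      by (intro Bochner_Integration.integral_cong) (auto simp: indicator_def)
    finally show ?thesis using ftc by simp
  qed
  have I1: "integrable interval_lebesgue (\<lambda>t. indicator {a..b} t * f' t)"
    using integrable_mult_indicator[of "{a..b}" interval_lebesgue f'] int1 ab
    by (simp add: sets_restrict_space_iff)
  have I2: "integrable interval_lebesgue (\<lambda>t. indicator {a..b} t * (f' t)\<^sup>2)"
    using integrable_mult_indicator[of "{a..b}" interval_lebesgue "\<lambda>t. (f' t)\<^sup>2"] int ab
    by (simp add: sets_restrict_space_iff)
  have I0: "integrable interval_lebesgue (indicator {a..b} :: real \<Rightarrow> real)"
    using ab by (simp add: sets_restrict_space_iff I.emeasure_eq_measure)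
  have L: "(\<integral>t. indicator {a..b} t \<partial>interval_lebesgue) = b - a"
    using ab by (simp add: measure_restrict_space)
  show ?thesis
  proof (cases "a = b")
    case False
    \<comment> \<open>Cauchy-Schwarz is obtained directly: \<open>c\<close> is the mean of
      \<open>f'\<close> on [a,b], and the integral of \<open>(f' t - c)\<^sup>2\<close> over [a,b]
      is nonnegative.\<close>
    define c where "c = (f b - f a) / (b - a)"
    let ?J = "\<integral>t. indicator {a..b} t * (f' t)\<^sup>2 \<partial>interval_lebesgue"
    have "0 \<le> (\<integral>t. indicator {a..b} t * (f' t - c)\<^sup>2 \<partial>interval_lebesgue)"
      by (intro integral_nonneg_AE) auto
    also have "\<dots> = (\<integral>t. indicator {a..b} t * (f' t)\<^sup>2 - 2 * c * (indicator {a..b} t * f' t) + c\<^sup>2 * indicator {a..b} t \<partial>interval_lebesgue)"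
      by (intro Bochner_Integration.integral_cong) (auto simp: power2_eq_square algebra_simps)
    also have "\<dots> = ?J - 2 * c * (f b - f a) + c\<^sup>2 * (b - a)"
      using I0 I1 I2 L ftc' by (simp add: Bochner_Integration.integral_add Bochner_Integration.integral_diff)
    also have "\<dots> = ?J - c * (f b - f a)"
    proof -
      have "c * (b - a) = f b - f a"
        using False by (simp add: c_def)
      then have "c\<^sup>2 * (b - a) = c * (f b - f a)"
        by (simp add: power2_eq_square)
      then show ?thesis by simp
    qed
    finally have "(b - a) * (c * (f b - f a)) \<le> (b - a) * ?J"
      using ab by (intro mult_left_mono) auto
    moreover have "(b - a) * (c * (f b - f a)) = (f b - f a)\<^sup>2"
      using False by (simp add: c_def power2_eq_square)
    ultimately show ?thesis by simp
  qed simp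
qed

lemma variance_le_weighted_derivative:
  fixes f f' :: "real \<Rightarrow> real"
  assumes deriv: "\<And>t. t \<in> {0..1} \<Longrightarrow> (f has_vector_derivative f' t) (at t within {0..1})"
    and meas[measurable]: "f' \<in> borel_measurable interval_lebesgue"
    and int: "integrable interval_lebesgue (\<lambda>t. (f' t)\<^sup>2)"
  shows "(\<integral>t. (f t - (\<integral>s. f s \<partial>interval_lebesgue))\<^sup>2 \<partial>interval_lebesgue)
    \<le> 1 / 2 * (\<integral>t. t * (1 - t) * (f' t)\<^sup>2 \<partial>interval_lebesgue)"
proof -
  have cont: "continuous_on {0..1} f"
    using deriv by (intro continuous_on_vector_derivative) auto
  then have fm[measurable]: "f \<in> borel_measurable interval_lebesgue"
    using borel_measurable_continuous_on_restrict[of "{0..1}" f]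
    by (simp cong: measurable_cong_sets sets_restrict_space_cong)
  have id_m[measurable]: "(\<lambda>x. x) \<in> borel_measurable interval_lebesgue"
    by (rule measurable_ident_restrict_lborel)
  obtain B where B: "\<And>x. x \<in> {0..1} \<Longrightarrow> \<bar>f x\<bar> \<le> B"
    using compact_imp_bounded[OF compact_continuous_image[OF cont]] by (force simp: bounded_iff)
  have f1: "integrable interval_lebesgue f"
    using B by (intro I.integrable_const_bound[where B=B]) (auto simp: AE_restrict_space_iff)
  have f2: "integrable interval_lebesgue (\<lambda>x. (f x)\<^sup>2)"
  proof (rule I.integrable_const_bound[where B="B\<^sup>2"])
    have "(f x)\<^sup>2 \<le> B\<^sup>2" if "x \<in> {0..1}" for x
      using B[OF that] by (simp add: abs_le_square_iff[symmetric])
    then show "AE x in interval_lebesgue. norm ((f x)\<^sup>2) \<le> B\<^sup>2"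
      by (simp add: AE_restrict_space_iff)
  qed measurable
  have one: "measure interval_lebesgue (space interval_lebesgue) = 1"
    by (simp add: space_restrict_space measure_restrict_space)
  define m where "m = (\<integral>s. f s \<partial>interval_lebesgue)"
  define V where "V = (\<integral>t. (f t - m)\<^sup>2 \<partial>interval_lebesgue)"
  have V: "V = (\<integral>t. (f t)\<^sup>2 \<partial>interval_lebesgue) - m\<^sup>2"
  proof -
    have "V = (\<integral>t. (f t)\<^sup>2 - 2 * m * f t + m\<^sup>2 \<partial>interval_lebesgue)"
      unfolding V_def by (simp add: power2_eq_square algebra_simps)
    then show ?thesis
      using f1 f2 one by (simp add: m_def power2_eq_square)
  qed
  \<comment> \<open>Expand the square; the interval has mass 1 and the second moment of
    \<open>f\<close> is \<open>V + m\<^sup>2\<close>. Integrating once more over \<open>x\<close>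
    gives \<open>2 * V\<close>.\<close>
  have inner: "(\<integral>y. (f x - f y)\<^sup>2 \<partial>interval_lebesgue) = (f x - m)\<^sup>2 + V"
    "integrable interval_lebesgue (\<lambda>y. (f x - f y)\<^sup>2)" for x
  proof -
    have "(\<lambda>y. (f x - f y)\<^sup>2) = (\<lambda>y. (f y)\<^sup>2 - 2 * f x * f y + (f x)\<^sup>2)"
      by (auto simp: power2_eq_square algebra_simps)
    then show "(\<integral>y. (f x - f y)\<^sup>2 \<partial>interval_lebesgue) = (f x - m)\<^sup>2 + V"
      "integrable interval_lebesgue (\<lambda>y. (f x - f y)\<^sup>2)"
      using f1 f2 one V by (simp_all add: m_def power2_eq_square algebra_simps)
  qed
  have sqint: "integrable interval_lebesgue (\<lambda>x. (f x - m)\<^sup>2)"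
    using f1 f2 by (simp add: power2_diff)
  have V0: "0 \<le> V"
    unfolding V_def by (intro integral_nonneg_AE) auto
  \<comment> \<open>From here on the integrals take extended nonnegative values, so that the
    exchanges of order below rest on measurability alone.\<close>
  have "ennreal (2 * V) = (\<integral>\<^sup>+x. ennreal ((f x - m)\<^sup>2 + V) \<partial>interval_lebesgue)"
    using sqint one V0 by (subst nn_integral_eq_integral) (auto simp: V_def)
  also have "\<dots> = (\<integral>\<^sup>+x. \<integral>\<^sup>+y. ennreal ((f x - f y)\<^sup>2) \<partial>interval_lebesgue \<partial>interval_lebesgue)"
    using inner by (intro nn_integral_cong) (simp add: nn_integral_eq_integral)
  also have "\<dots> \<le> (\<integral>\<^sup>+x. \<integral>\<^sup>+y. \<integral>\<^sup>+s. ennreal ((f' s)\<^sup>2) * (if min x y \<le> s \<and> s \<le> max x y then ennreal \<bar>x - y\<bar> else 0)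
      \<partial>interval_lebesgue \<partial>interval_lebesgue \<partial>interval_lebesgue)"
  proof (intro nn_integral_mono)
    fix x y assume "x \<in> space interval_lebesgue" "y \<in> space interval_lebesgue"
    then have xy: "0 \<le> min x y" "min x y \<le> max x y" "max x y \<le> 1"
      by (auto simp: space_restrict_space)
    have mi: "integrable interval_lebesgue (\<lambda>t. indicator {min x y..max x y} t * (f' t)\<^sup>2)"
      using integrable_mult_indicator[of "{min x y..max x y}" interval_lebesgue "\<lambda>t. (f' t)\<^sup>2"] int xy
      by (simp add: sets_restrict_space_iff)
    have "(f x - f y)\<^sup>2 = (f (max x y) - f (min x y))\<^sup>2"
      by (auto simp: max_def min_def power2_commute)
    also have "\<dots> \<le> (max x y - min x y) * (\<integral>t. indicator {min x y..max x y} t * (f' t)\<^sup>2 \<partial>interval_lebesgue)"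
      by (rule increment_square_le[OF deriv meas int xy])
    also have "max x y - min x y = \<bar>x - y\<bar>" by auto
    finally have "ennreal ((f x - f y)\<^sup>2) \<le> ennreal (\<integral>t. \<bar>x - y\<bar> * (indicator {min x y..max x y} t * (f' t)\<^sup>2) \<partial>interval_lebesgue)"
      by (simp add: ennreal_leI)
    also have "\<dots> = (\<integral>\<^sup>+t. ennreal (\<bar>x - y\<bar> * (indicator {min x y..max x y} t * (f' t)\<^sup>2)) \<partial>interval_lebesgue)"
      using mi by (subst nn_integral_eq_integral) auto
    also have "\<dots> = (\<integral>\<^sup>+s. ennreal ((f' s)\<^sup>2) * (if min x y \<le> s \<and> s \<le> max x y then ennreal \<bar>x - y\<bar> else 0) \<partial>interval_lebesgue)"
      by (intro nn_integral_cong) (auto simp: indicator_def ennreal_mult' mult.commute)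
    finally show "ennreal ((f x - f y)\<^sup>2) \<le> \<dots>" .
  qed
  \<comment> \<open>Two exchanges bring \<open>s\<close> to the outermost place: first past
    \<open>y\<close>, then past \<open>x\<close>.\<close>
  also have "\<dots> = (\<integral>\<^sup>+x. \<integral>\<^sup>+s. \<integral>\<^sup>+y. ennreal ((f' s)\<^sup>2) * (if min x y \<le> s \<and> s \<le> max x y then ennreal \<bar>x - y\<bar> else 0)
      \<partial>interval_lebesgue \<partial>interval_lebesgue \<partial>interval_lebesgue)"
    by (intro nn_integral_cong II.Fubini') measurable
  also have "\<dots> = (\<integral>\<^sup>+s. \<integral>\<^sup>+x. \<integral>\<^sup>+y. ennreal ((f' s)\<^sup>2) * (if min x y \<le> s \<and> s \<le> max x y then ennreal \<bar>x - y\<bar> else 0)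
      \<partial>interval_lebesgue \<partial>interval_lebesgue \<partial>interval_lebesgue)"
    by (intro II.Fubini') measurable
  also have "\<dots> = (\<integral>\<^sup>+s. ennreal ((f' s)\<^sup>2) * (\<integral>\<^sup>+x. \<integral>\<^sup>+y. (if min x y \<le> s \<and> s \<le> max x y then ennreal \<bar>x - y\<bar> else 0)
      \<partial>interval_lebesgue \<partial>interval_lebesgue) \<partial>interval_lebesgue)"
    by (simp add: nn_integral_cmult)
  also have "\<dots> = (\<integral>\<^sup>+s. ennreal (s * (1 - s) * (f' s)\<^sup>2) \<partial>interval_lebesgue)"
    by (intro nn_integral_cong)
       (auto simp: space_restrict_space nn_integral_dist_separated_by ennreal_mult' mult.commute)
  also have "\<dots> = ennreal (\<integral>s. s * (1 - s) * (f' s)\<^sup>2 \<partial>interval_lebesgue)"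
  proof (rule nn_integral_eq_integral)
    \<comment> \<open>The weight lies between 0 and 1, so the integrand is dominated by the square
      of \<open>f'\<close>; this permits the return to a real-valued integral.\<close>
    show "integrable interval_lebesgue (\<lambda>s. s * (1 - s) * (f' s)\<^sup>2)"
    proof (rule Bochner_Integration.integrable_bound[OF int])
      show "AE s in interval_lebesgue. norm (s * (1 - s) * (f' s)\<^sup>2) \<le> norm ((f' s)\<^sup>2)"
      proof -
        have "\<bar>s * (1 - s)\<bar> * (f' s)\<^sup>2 \<le> (f' s)\<^sup>2" if "0 \<le> s" "s \<le> 1" for s
          using that by (intro mult_left_le_one_le) (auto simp: mult_le_one)
        then show ?thesis by (auto simp: AE_restrict_space_iff abs_mult)
      qed
    qed measurable
  qed (auto simp: AE_restrict_space_iff)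
  finally have "2 * V \<le> (\<integral>s. s * (1 - s) * (f' s)\<^sup>2 \<partial>interval_lebesgue)"
    by (subst (asm) ennreal_le_iff) (auto intro!: integral_nonneg_AE simp: AE_restrict_space_iff)
  then show ?thesis
    by (simp add: V_def m_def)
qed

subsection \<open>Existence of the ANOVA decomposition\<close>

text \<open>The projection that removes the dependence on one coordinate. The gauge integral is used
  since continuity in a parameter and the exchange of order for continuous integrands are stated for
  it.\<close>

definition average_coord :: "'n::finite \<Rightarrow> (real ^ 'n \<Rightarrow> real) \<Rightarrow> real ^ 'n \<Rightarrow> real" where
  "average_coord k f x = integral {0..1} (\<lambda>t. f (set_coord x k t))"

lemma continuous_on_compose_set_coord:
  "continuous_on UNIV f \<Longrightarrow> continuous_on S (\<lambda>t. f (set_coord x k t))"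
  by (rule continuous_on_compose2[of UNIV]) (auto intro!: continuous_intros)

lemma continuous_on_average_coord:
  assumes "continuous_on UNIV f"
  shows "continuous_on UNIV (average_coord k f)"
proof -
  have "continuous_on (UNIV \<times> cbox 0 1) (\<lambda>(x, t). f (set_coord x k t))"
    unfolding split_beta'
    by (rule continuous_on_compose2[OF assms]) (auto intro!: continuous_intros)
  from integral_continuous_on_param[OF this] show ?thesis
    by (simp add: average_coord_def[abs_def])
qed

lemma average_coord_set_coord_same [simp]: "average_coord k f (set_coord x k t) = average_coord k f x"
  by (simp add: average_coord_def)

text \<open>Fubini for continuous integrands. It is used to carry a vanishing average in direction
  \<open>j\<close> through an averaging in direction \<open>k\<close>.\<close>

lemma average_coord_commute:
  assumes f: "continuous_on UNIV f" and "j \<noteq> k"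
  shows "average_coord j (average_coord k f) x = average_coord k (average_coord j f) x"
proof -
  have "continuous_on (cbox (0, 0) (1, 1)) (\<lambda>(s, t). f (set_coord (set_coord x j s) k t))"
    unfolding split_beta'
    by (rule continuous_on_compose2[OF f]) (auto intro!: continuous_intros)
  from integral_swap_continuous[OF this] show ?thesis
    unfolding average_coord_def using \<open>j \<noteq> k\<close> by (simp add: set_coord_commute)
qed

lemma average_coord_diff:
  assumes "continuous_on UNIV f" "continuous_on UNIV g"
  shows "average_coord k (\<lambda>x. f x - g x) x = average_coord k f x - average_coord k g x"
  unfolding average_coord_def
  by (intro Henstock_Kurzweil_Integration.integral_diff integrable_continuous_real
      continuous_on_compose_set_coord assms)

lemma average_coord_eq_self:
  assumes "\<And>t. f (set_coord x k t) = f x"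
  shows "average_coord k f x = f x"
  using assms by (simp add: average_coord_def)

lemma average_coord_cong_set_coord:
  assumes "\<And>t. f (set_coord x k t) = f (set_coord y k t)"
  shows "average_coord k f x = average_coord k f y"
  using assms by (simp add: average_coord_def)

text \<open>The induction decomposes with respect to the coordinates in \<open>S\<close> only; the components may still
  depend on all the coordinates outside \<open>S\<close>. A new coordinate \<open>k\<close> splits each component into its
  average over \<open>k\<close> and the rest.\<close>

lemma continuous_anova_exists:
  fixes f :: "real ^ 'n \<Rightarrow> real"
  assumes "finite S" "continuous_on UNIV f"
  shows "\<exists>g. (\<forall>u. continuous_on UNIV (g u)) \<and>
    (\<forall>u x y. (\<forall>j. j \<in> u \<or> j \<notin> S \<longrightarrow> x $ j = y $ j) \<longrightarrow> g u x = g u y) \<and>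
    (\<forall>u. \<forall>j\<in>u. \<forall>x. average_coord j (g u) x = 0) \<and>
    (\<forall>x. f x = (\<Sum>u\<in>Pow S. g u x))"
  using assms(1)
proof (induction S)
  case empty
  show ?case
    \<comment> \<open>With no coordinate split off, \<open>f\<close> itself is the component at the
      empty set. The dependence condition is trivial, as all coordinates then lie outside
      \<open>S\<close>.\<close>
    by (rule exI[of _ "\<lambda>u. if u = {} then f else (\<lambda>_. 0)"])
       (auto simp: assms(2) average_coord_def vec_eq_iff[symmetric])
next
  case (insert k S)
  then obtain g where cont': "\<forall>u. continuous_on UNIV (g u)"
    and dep': "\<forall>u x y. (\<forall>j. j \<in> u \<or> j \<notin> S \<longrightarrow> x $ j = y $ j) \<longrightarrow> g u x = g u y"
    and zero': "\<forall>u. \<forall>j\<in>u. \<forall>x. average_coord j (g u) x = 0"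
    and total: "\<forall>x. f x = (\<Sum>u\<in>Pow S. g u x)"
    by (elim exE conjE)
  note cont = cont'[rule_format] and zero = zero'[rule_format]
  have dep: "g u x = g u y" if "\<And>j. j \<in> u \<or> j \<notin> S \<Longrightarrow> x $ j = y $ j" for u x y
    using dep' that by simp
  \<comment> \<open>For \<open>u\<close> inside \<open>S\<close>, the old component
    \<open>g u\<close> equals \<open>h u + h (insert k u)\<close>, so the total is preserved when
    the subsets of \<open>insert k S\<close> are grouped in pairs.\<close>
  define h where "h u = (if k \<in> u then (\<lambda>x. g (u - {k}) x - average_coord k (g (u - {k})) x)
    else average_coord k (g u))" for u
  have "continuous_on UNIV (h u)" for u
    by (auto simp: h_def intro!: continuous_intros cont continuous_on_average_coord)
  moreover have "h u x = h u y" if agree: "\<And>j. j \<in> u \<or> j \<notin> insert k S \<Longrightarrow> x $ j = y $ j" for u x y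
  proof (cases "k \<in> u")
    case True
    then have agree': "\<forall>j. j \<in> u \<or> j \<notin> S \<longrightarrow> x $ j = y $ j"
      using agree by (metis insert_iff)
    have "g (u - {k}) x = g (u - {k}) y"
      using agree' by (intro dep) auto
    moreover have "average_coord k (g (u - {k})) x = average_coord k (g (u - {k})) y"
      using agree' by (intro average_coord_cong_set_coord dep) auto
    ultimately show ?thesis using True by (simp add: h_def)
  next
    case False
    have "average_coord k (g u) x = average_coord k (g u) y"
    proof (intro average_coord_cong_set_coord dep)
      fix t j assume "j \<in> u \<or> j \<notin> S"
      \<comment> \<open>Among the coordinates in \<open>u\<close> or outside \<open>S\<close>, only
        the \<open>k\<close>-th may differ between \<open>x\<close> and \<open>y\<close>, and both
        points receive the same value \<open>t\<close> there.\<close>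
      then show "set_coord x k t $ j = set_coord y k t $ j"
        using agree[of j] by auto
    qed
    then show ?thesis
      using False by (simp add: h_def)
  qed
  moreover have "average_coord j (h u) x = 0" if "j \<in> u" for u j x
  proof (cases "k \<in> u")
    case True
    have *: "average_coord j (h u) x
      = average_coord j (g (u - {k})) x - average_coord j (average_coord k (g (u - {k}))) x"
      using True by (simp add: h_def average_coord_diff cont continuous_on_average_coord)
    show ?thesis
    proof (cases "j = k")
      case True
      then show ?thesis unfolding * by (simp add: average_coord_eq_self)
    next
      case False
      \<comment> \<open>After the two averages are swapped, the inner one vanishes because
        \<open>j\<close> belongs to \<open>u - {k}\<close>.\<close>
      have "average_coord k (average_coord j (g (u - {k}))) x = 0"
        using False that by (simp add: average_coord_def[of k] zero)
      then show ?thesis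
        unfolding * using that False by (simp add: zero average_coord_commute[OF cont])
    qed
  next
    case False
    with that have "j \<noteq> k" by auto
    moreover have "average_coord k (average_coord j (g u)) x = 0"
      using that by (simp add: average_coord_def[of k] zero)
    ultimately show ?thesis
      using False by (simp add: h_def average_coord_commute[OF cont])
  qed
  moreover have "f x = (\<Sum>u\<in>Pow (insert k S). h u x)" for x
  proof -
    have "(\<Sum>u\<in>Pow (insert k S). h u x) = (\<Sum>u\<in>Pow S. h u x) + (\<Sum>u\<in>insert k ` Pow S. h u x)"
      unfolding Pow_insert using insert.hyps by (intro sum.union_disjoint) auto
    also have "(\<Sum>u\<in>insert k ` Pow S. h u x) = (\<Sum>u\<in>Pow S. h (insert k u) x)"
    proof (rule sum.reindex[unfolded o_def])
      show "inj_on (insert k) (Pow S)"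
        using insert.hyps by (intro inj_onI) (metis PowD insert_ident subsetD)
    qed
    also have "(\<Sum>u\<in>Pow S. h u x) = (\<Sum>u\<in>Pow S. average_coord k (g u) x)"
      using insert.hyps by (intro sum.cong) (auto simp: h_def)
    also have "(\<Sum>u\<in>Pow S. h (insert k u) x) = (\<Sum>u\<in>Pow S. g u x - average_coord k (g u) x)"
    proof (intro sum.cong refl)
      fix u assume "u \<in> Pow S"
      then have "insert k u - {k} = u" using insert.hyps by auto
      then show "h (insert k u) x = g u x - average_coord k (g u) x"
        by (simp add: h_def)
    qed
    finally show ?thesis
      by (simp add: total sum_subtractf)
  qed
  ultimately show ?case
    by (intro exI[of _ h]) blast
qed

lemma square_integrable_cube_continuous:
  assumes "continuous_on UNIV f"
  shows "square_integrable_cube f"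
proof -
  have "f \<in> borel_measurable borel"
    using assms by (rule borel_measurable_continuous_onI)
  then have "set_borel_measurable lborel unit_cube f"
    unfolding set_borel_measurable_def by measurable
  moreover have "set_integrable lborel unit_cube (\<lambda>x. (f x)\<^sup>2)"
    unfolding set_integrable_def using assms
    by (intro borel_integrable_compact) (auto intro!: continuous_intros intro: continuous_on_subset)
  ultimately show ?thesis
    by (simp add: square_integrable_cube_def)
qed

text \<open>\<open>anova_component\<close> is a \<open>SOME\<close> choice, so its properties rest
  on this existence. Continuity of \<open>f\<close>, which differentiability will supply, keeps all
  iterated averages continuous and makes the identities hold everywhere on the cube.\<close>

lemma anova_decomposition_exists:
  fixes f :: "real ^ 'n \<Rightarrow> real"
  assumes "continuous_on unit_cube f"
  shows "\<exists>g. anova_decomposition f g"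
proof -
  \<comment> \<open>Clamping extends \<open>f\<close> from the cube to a continuous function on the
    whole space without changing its values on the cube.\<close>
  have "continuous_on UNIV (\<lambda>x. f (clamp 0 1 x))"
    using assms by (rule clamp_continuous_on)
  from continuous_anova_exists[OF finite[of UNIV] this] obtain g where
    cont: "\<And>u. continuous_on UNIV (g u)"
    and dep: "\<And>u x y. (\<forall>j\<in>u. x $ j = y $ j) \<Longrightarrow> g u x = g u y"
    and zero: "\<And>u j x. j \<in> u \<Longrightarrow> average_coord j (g u) x = 0"
    and total: "\<And>x. f (clamp 0 1 x) = (\<Sum>u\<in>UNIV. g u x)"
    by (simp add: Ball_def) metis
  have "(LINT t:{0..1}|lborel. g u (set_coord x j t)) = 0" if "j \<in> u" for u j x
  proof -
    have "set_integrable lborel {0..1} (\<lambda>t. g u (set_coord x j t))"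
      unfolding set_integrable_def
      by (intro borel_integrable_compact continuous_on_compose_set_coord cont) auto
    from set_borel_integral_eq_integral(2)[OF this] show ?thesis
      using zero[OF that] by (simp add: average_coord_def)
  qed
  moreover have "f x = (\<Sum>u\<in>UNIV. g u x)" if "x \<in> unit_cube" for x
    using total[of x] that by simp
  ultimately have "anova_decomposition f g"
    unfolding anova_decomposition_def
    using dep by (auto intro!: square_integrable_cube_continuous cont)
  then show ?thesis by blast
qed

subsection \<open>Total variance\<close>

lemma set_lebesgue_integral_cube:
  fixes f :: "real ^ 'n \<Rightarrow> real"
  shows "(LINT x:unit_cube|lborel. f x) = (\<integral>x. f x \<partial>cube_measure)"
  by (subst integral_restrict_space) (auto simp: set_lebesgue_integral_def)

lemma square_integrable_cube_iff:
  "square_integrable_cube f \<longleftrightarrow>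
    f \<in> borel_measurable cube_measure \<and> integrable cube_measure (\<lambda>x. (f x)\<^sup>2)"
proof -
  have "unit_cube \<inter> space lborel \<in> sets (lborel :: (real ^ 'a) measure)"
    by simp
  then show ?thesis
    by (simp only: square_integrable_cube_def set_borel_measurable_def set_integrable_def
        borel_measurable_restrict_space_iff integrable_restrict_space)
qed

lemma integrable_mult_of_squares:
  fixes f g :: "'a \<Rightarrow> real"
  assumes [measurable]: "f \<in> borel_measurable M" "g \<in> borel_measurable M"
    and "integrable M (\<lambda>x. (f x)\<^sup>2)" "integrable M (\<lambda>x. (g x)\<^sup>2)"
  shows "integrable M (\<lambda>x. f x * g x)"
proof (rule Bochner_Integration.integrable_bound)
  show "integrable M (\<lambda>x. (f x)\<^sup>2 + (g x)\<^sup>2)"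
    using assms by simp
  have "\<bar>a * b\<bar> \<le> a\<^sup>2 + b\<^sup>2" for a b :: real
  proof -
    have "2 * \<bar>a\<bar> * \<bar>b\<bar> \<le> a\<^sup>2 + b\<^sup>2"
      using sum_squares_bound[of "\<bar>a\<bar>" "\<bar>b\<bar>"] by simp
    moreover have "0 \<le> \<bar>a\<bar> * \<bar>b\<bar>" by simp
    ultimately show ?thesis unfolding abs_mult by linarith
  qed
  then show "AE x in M. norm (f x * g x) \<le> norm ((f x)\<^sup>2 + (g x)\<^sup>2)"
    by simp
qed measurable

lemma measurable_set_coord_section:
  assumes "h \<in> borel_measurable cube_measure" "x \<in> unit_cube"
  shows "(\<lambda>t. h (set_coord x j t)) \<in> borel_measurable interval_lebesgue"
proof -
  have "x \<in> space cube_measure"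
    using assms(2) by (simp add: space_restrict_space)
  from measurable_compose[OF measurable_Pair1'[OF this] measurable_compose[OF measurable_set_coord_cube assms(1)]]
  show ?thesis by simp
qed

text \<open>A null set meets almost every line in direction \<open>j\<close> in a null set: pull it
  back along the resampling map and apply Fubini.\<close>

lemma AE_cube_set_coord:
  assumes "AE x in cube_measure. P x"
  shows "AE x in cube_measure. AE t in interval_lebesgue. P (set_coord x j t)"
proof -
  have "AE z in cube_measure \<Otimes>\<^sub>M interval_lebesgue. P (case z of (x, t) \<Rightarrow> set_coord x j t)"
    using assms by (subst (asm) cube_measure_eq_distr_set_coord[of j])
      (rule AE_distrD[OF measurable_set_coord_cube])
  from CI.AE_pair[OF this] show ?thesis by simp
qed

text \<open>Fubini along the lines in direction \<open>j\<close>: the invariance under resampling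
  transports \<open>h\<close> to the product of cube and interval. The cube integral then still runs
  over all coordinates, but the inner integral no longer depends on the \<open>j\<close>-th.\<close>

lemma
  fixes h :: "real ^ 'n \<Rightarrow> real"
  assumes "integrable cube_measure h"
  shows AE_integrable_set_coord:
      "AE x in cube_measure. integrable interval_lebesgue (\<lambda>t. h (set_coord x j t))" (is ?A)
    and integrable_integral_set_coord:
      "integrable cube_measure (\<lambda>x. \<integral>t. h (set_coord x j t) \<partial>interval_lebesgue)" (is ?B)
    and integral_integral_set_coord:
      "(\<integral>x. \<integral>t. h (set_coord x j t) \<partial>interval_lebesgue \<partial>cube_measure) = (\<integral>x. h x \<partial>cube_measure)" (is ?C)
proof -
  let ?h = "\<lambda>z. h (case z of (x, t) \<Rightarrow> set_coord x j t)"
  have int: "integrable (cube_measure \<Otimes>\<^sub>M interval_lebesgue) ?h"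
    using assms by (subst (asm) cube_measure_eq_distr_set_coord[of j])
      (rule integrable_distr[OF measurable_set_coord_cube])
  show ?A ?B
    using CI.AE_integrable_fst'[OF int] CI.integrable_fst'[OF int] by simp_all
  have "(\<integral>x. h x \<partial>cube_measure) = integral\<^sup>L (cube_measure \<Otimes>\<^sub>M interval_lebesgue) ?h"
    using assms by (subst cube_measure_eq_distr_set_coord[of j], subst integral_distr) auto
  then show ?C
    using CI.integral_fst'[OF int] by simp
qed

section \<open>Orthogonality of the components of an arbitrary ANOVA decomposition\<close>

context
  fixes f :: "real ^ 'n \<Rightarrow> real" and g
  assumes anova: "anova_decomposition f g"
begin

lemma anova_measurable [measurable]: "g u \<in> borel_measurable cube_measure"
  and anova_square_integrable: "integrable cube_measure (\<lambda>x. (g u x)\<^sup>2)"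
proof -
  have "square_integrable_cube (g u)"
    using anova unfolding anova_decomposition_def by blast
  then show "g u \<in> borel_measurable cube_measure" "integrable cube_measure (\<lambda>x. (g u x)\<^sup>2)"
    by (simp_all add: square_integrable_cube_iff)
qed

lemma anova_integrable: "integrable cube_measure (g u)"
  by (rule C.square_integrable_imp_integrable[OF anova_measurable anova_square_integrable])

lemma anova_set_coord:
  assumes "j \<notin> u" "x \<in> unit_cube" "t \<in> {0..1}"
  shows "g u (set_coord x j t) = g u x"
proof -
  have dep: "\<forall>u. \<forall>x\<in>unit_cube. \<forall>y\<in>unit_cube. (\<forall>j\<in>u. x $ j = y $ j) \<longrightarrow> g u x = g u y"
    using anova unfolding anova_decomposition_def by (elim conjE)
  have "set_coord x j t \<in> unit_cube" "\<forall>k\<in>u. set_coord x j t $ k = x $ k"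
    using assms by auto
  with dep assms(2) show ?thesis by blast
qed

lemma anova_integral_zero:
  assumes "j \<in> u"
  shows "AE x in cube_measure. (\<integral>t. g u (set_coord x j t) \<partial>interval_lebesgue) = 0"
proof -
  have "AE x in lborel. x \<in> unit_cube \<longrightarrow> (LINT t:{0..1}|lborel. g u (set_coord x j t)) = 0"
    using anova assms unfolding anova_decomposition_def by blast
  then show ?thesis
    by (simp add: AE_restrict_space_iff integral_restrict_space set_lebesgue_integral_def)
qed

lemma anova_sum: "AE x in cube_measure. f x = (\<Sum>u\<in>UNIV. g u x)"
proof -
  have "AE x in lborel. x \<in> unit_cube \<longrightarrow> f x = (\<Sum>u\<in>UNIV. g u x)"
    using anova unfolding anova_decomposition_def by (elim conjE)
  then show ?thesis by (simp add: AE_restrict_space_iff)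
qed

text \<open>Integrate first along the lines in direction \<open>j\<close>: there \<open>g v\<close>
  is constant and can be taken out, while \<open>g u\<close> has mean zero on almost every
  line.\<close>

lemma anova_orthogonal_aux:
  assumes "j \<in> u" "j \<notin> v"
  shows "(\<integral>x. g u x * g v x \<partial>cube_measure) = 0"
proof -
  have "integrable cube_measure (\<lambda>x. g u x * g v x)"
    by (intro integrable_mult_of_squares anova_measurable anova_square_integrable)
  from integral_integral_set_coord[OF this, of j]
  have "(\<integral>x. g u x * g v x \<partial>cube_measure)
      = (\<integral>x. \<integral>t. g u (set_coord x j t) * g v (set_coord x j t) \<partial>interval_lebesgue \<partial>cube_measure)"
    by simp
  also have "\<dots> = (\<integral>x. (\<integral>t. g u (set_coord x j t) \<partial>interval_lebesgue) * g v x \<partial>cube_measure)"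
  proof (intro Bochner_Integration.integral_cong refl)
    fix x assume "x \<in> space (cube_measure :: (real ^ 'n) measure)"
    then have "x \<in> unit_cube" by (simp add: space_restrict_space)
    then have "(\<integral>t. g u (set_coord x j t) * g v (set_coord x j t) \<partial>interval_lebesgue)
        = (\<integral>t. g u (set_coord x j t) * g v x \<partial>interval_lebesgue)"
      using assms by (intro Bochner_Integration.integral_cong refl)
        (simp add: space_restrict_space anova_set_coord)
    then show "(\<integral>t. g u (set_coord x j t) * g v (set_coord x j t) \<partial>interval_lebesgue)
        = (\<integral>t. g u (set_coord x j t) \<partial>interval_lebesgue) * g v x"
      by simp
  qed
  also have "\<dots> = 0"
    using anova_integral_zero[OF assms(1)]
    by (intro integral_eq_zero_AE) (auto elim: eventually_mono)
  finally show ?thesis .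
qed

lemma anova_orthogonal:
  assumes "u \<noteq> v"
  shows "(\<integral>x. g u x * g v x \<partial>cube_measure) = 0"
proof -
  from assms obtain j where "j \<in> u \<and> j \<notin> v \<or> j \<in> v \<and> j \<notin> u" by blast
  then show ?thesis
    using anova_orthogonal_aux[of j u v] anova_orthogonal_aux[of j v u] by (auto simp: mult.commute)
qed

text \<open>Pythagoras: the cross terms of the expanded square vanish. Taken over all
  \<open>u\<close> that contain \<open>i\<close>, it turns the total variance into the integral of a
  single square.\<close>

lemma anova_sum_square:
  "integrable cube_measure (\<lambda>x. (\<Sum>u\<in>U. g u x)\<^sup>2)"
  "(\<integral>x. (\<Sum>u\<in>U. g u x)\<^sup>2 \<partial>cube_measure) = (\<Sum>u\<in>U. \<integral>x. (g u x)\<^sup>2 \<partial>cube_measure)"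
proof -
  have eq: "(\<Sum>u\<in>U. g u x)\<^sup>2 = (\<Sum>u\<in>U. \<Sum>v\<in>U. g u x * g v x)" for x
    by (simp add: power2_eq_square sum_product)
  have int: "integrable cube_measure (\<lambda>x. g u x * g v x)" for u v
    by (intro integrable_mult_of_squares anova_measurable anova_square_integrable)
  show "integrable cube_measure (\<lambda>x. (\<Sum>u\<in>U. g u x)\<^sup>2)"
    unfolding eq by (intro Bochner_Integration.integrable_sum int)
  have "(\<integral>x. (\<Sum>u\<in>U. g u x)\<^sup>2 \<partial>cube_measure) = (\<Sum>u\<in>U. \<Sum>v\<in>U. \<integral>x. g u x * g v x \<partial>cube_measure)"
    unfolding eq by (simp add: Bochner_Integration.integral_sum Bochner_Integration.integrable_sum int)
  also have "\<dots> = (\<Sum>u\<in>U. \<Sum>v\<in>U. if v = u then \<integral>x. (g u x)\<^sup>2 \<partial>cube_measure else 0)"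
    by (intro sum.cong) (auto simp: anova_orthogonal power2_eq_square)
  also have "\<dots> = (\<Sum>u\<in>U. \<integral>x. (g u x)\<^sup>2 \<partial>cube_measure)"
    by (simp add: sum.delta)
  finally show "(\<integral>x. (\<Sum>u\<in>U. g u x)\<^sup>2 \<partial>cube_measure) = (\<Sum>u\<in>U. \<integral>x. (g u x)\<^sup>2 \<partial>cube_measure)" .
qed

end

text \<open>\<open>partial_derivative\<close> only names a derivative; that it is one comes from the
  chain rule along an affine segment. Moving the base point along the segment does not change the
  function of \<open>s\<close>, so one formula serves all \<open>t\<close>.\<close>

lemma has_vector_derivative_set_coord:
  fixes f :: "real ^ 'n \<Rightarrow> real"
  assumes f: "f differentiable_on unit_cube" and x: "x \<in> unit_cube" and t: "t \<in> {0..1}"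
  shows "((\<lambda>s. f (set_coord x i s)) has_vector_derivative partial_derivative i f (set_coord x i t))
    (at t within {0..1})"
proof -
  have line: "set_coord x i = (\<lambda>s. set_coord x i 0 + s *\<^sub>R axis i 1)"
    by (simp add: fun_eq_iff vec_eq_iff axis_def)
  have 1: "set_coord x i differentiable at t within {0..1}"
    by (subst line) (intro derivative_intros)
  have "f differentiable at (set_coord x i t) within unit_cube"
    using f x t by (auto simp: differentiable_on_def)
  \<comment> \<open>The segment stays in the cube, so differentiability within the cube restricts to
    the image of [0,1], as the chain rule requires.\<close>
  then have 2: "f differentiable at (set_coord x i t) within set_coord x i ` {0..1}"
    by (rule differentiable_subset) (use x in auto)
  have "(\<lambda>s. f (set_coord x i s)) differentiable at t within {0..1}"
    using differentiable_chain_within[OF 1 2] by (simp add: o_def)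
  then show ?thesis
    by (simp add: partial_derivative_def vector_derivative_works)
qed

section \<open>Integration of the one-dimensional inequality over the lines in direction
  \<open>i\<close>\<close>

theorem theorem5:
  fixes G :: "real ^ 'n \<Rightarrow> real" and i :: 'n
  assumes "G differentiable_on unit_cube"
    and "square_integrable_cube G"
    and "cube_variance G > 0"
    and "square_integrable_cube (partial_derivative i G)"
  shows "total_sobol_index i G \<le> dgsm i G / cube_variance G"
proof -
  define g where "g = anova_component G"
  have "\<exists>g. anova_decomposition G g"
    by (intro anova_decomposition_exists differentiable_imp_continuous_on assms)
  then have anova: "anova_decomposition G g"
    unfolding g_def anova_component_def by (rule someI_ex)
  define D where "D = partial_derivative i G"
  have Dm [measurable]: "D \<in> borel_measurable cube_measure" and D2: "integrable cube_measure (\<lambda>x. (D x)\<^sup>2)"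
    using assms(4) by (simp_all add: D_def square_integrable_cube_iff)
  \<comment> \<open>\<open>w\<close> collects the components that depend on the \<open>i\<close>-th
    coordinate; the remainder \<open>r\<close> is constant along lines in direction
    \<open>i\<close>.\<close>
  define w where "w x = (\<Sum>u\<in>{u. i \<in> u}. g u x)" for x
  define r where "r x = (\<Sum>u\<in>{u. i \<notin> u}. g u x)" for x
  have [measurable]: "w \<in> borel_measurable cube_measure"
    unfolding w_def by (intro borel_measurable_sum anova_measurable[OF anova])
  have w1: "integrable cube_measure w" and w2: "integrable cube_measure (\<lambda>x. (w x)\<^sup>2)"
    unfolding w_def using anova_integrable[OF anova] anova_sum_square(1)[OF anova]
    by (auto intro!: Bochner_Integration.integrable_sum)
  have "AE x in cube_measure. G x = w x + r x"
    using anova_sum[OF anova]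
  proof eventually_elim
    case (elim x)
    have "(\<Sum>u\<in>UNIV. g u x) = w x + r x"
      unfolding w_def r_def by (subst sum.union_disjoint[symmetric]) (auto intro!: sum.cong)
    with elim show ?case by simp
  qed
  from AE_cube_set_coord[OF this]
  have split: "AE x in cube_measure. AE t in interval_lebesgue.
      G (set_coord x i t) = w (set_coord x i t) + r (set_coord x i t)" .
  have w_mean: "AE x in cube_measure. (\<integral>t. w (set_coord x i t) \<partial>interval_lebesgue) = 0"
  proof -
    \<comment> \<open>There are finitely many \<open>u\<close>, so one null set of lines serves all
      of them; integrability on each line justifies exchanging the sum with the integral.\<close>
    have "AE x in cube_measure. \<forall>u. integrable interval_lebesgue (\<lambda>t. g u (set_coord x i t))"
      by (subst AE_all_countable) (auto intro: AE_integrable_set_coord anova_integrable[OF anova] countable_finite)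
    moreover have "AE x in cube_measure. \<forall>u. i \<in> u \<longrightarrow> (\<integral>t. g u (set_coord x i t) \<partial>interval_lebesgue) = 0"
      using anova_integral_zero[OF anova] by (subst AE_all_countable) auto
    ultimately show ?thesis
      by eventually_elim (simp add: w_def Bochner_Integration.integral_sum)
  qed
  have weighted: "integrable cube_measure (\<lambda>x. x $ i * (1 - x $ i) * (D x)\<^sup>2)"
  proof (rule Bochner_Integration.integrable_bound[OF D2])
    have [measurable]: "(\<lambda>x. x $ i) \<in> borel_measurable cube_measure"
      by (intro measurable_restrict_space1) simp
    show "(\<lambda>x. x $ i * (1 - x $ i) * (D x)\<^sup>2) \<in> borel_measurable cube_measure"
      by measurable
    have "\<bar>x $ i * (1 - x $ i)\<bar> * (D x)\<^sup>2 \<le> (D x)\<^sup>2" if "x \<in> unit_cube" for x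
      using that by (intro mult_left_le_one_le) (auto simp: mem_box_cart abs_mult intro!: mult_le_one)
    then show "AE x in cube_measure. norm (x $ i * (1 - x $ i) * (D x)\<^sup>2) \<le> norm ((D x)\<^sup>2)"
      by (auto simp: AE_restrict_space_iff abs_mult)
  qed
  have "AE x in cube_measure. (\<integral>t. (w (set_coord x i t))\<^sup>2 \<partial>interval_lebesgue)
      \<le> 1 / 2 * (\<integral>t. t * (1 - t) * (D (set_coord x i t))\<^sup>2 \<partial>interval_lebesgue)"
    using split w_mean AE_integrable_set_coord[OF w1, of i] AE_integrable_set_coord[OF D2, of i] AE_space
  proof eventually_elim
    case (elim x)
    then have x: "x \<in> unit_cube" by (simp add: space_restrict_space)
    let ?f = "\<lambda>t. G (set_coord x i t)"
    have r: "r (set_coord x i t) = r x" if "t \<in> {0..1}" for t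
      unfolding r_def using x that by (intro sum.cong) (auto simp: anova_set_coord[OF anova])
    have deriv: "(?f has_vector_derivative D (set_coord x i t)) (at t within {0..1})" if "t \<in> {0..1}" for t
      unfolding D_def using assms(1) x that by (rule has_vector_derivative_set_coord)
    have cont: "continuous_on {0..1} ?f"
      using deriv by (rule continuous_on_vector_derivative)
    have fm: "?f \<in> borel_measurable interval_lebesgue"
      using borel_measurable_continuous_on_restrict[OF cont]
      by (simp cong: measurable_cong_sets sets_restrict_space_cong)
    have wm: "(\<lambda>t. w (set_coord x i t)) \<in> borel_measurable interval_lebesgue"
      by (intro measurable_set_coord_section x) measurable
    have fw: "AE t in interval_lebesgue. ?f t = w (set_coord x i t) + r x"
      using elim(1) AE_space by eventually_elim (simp add: r space_restrict_space)
    have one: "measure interval_lebesgue (space interval_lebesgue) = 1"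
      by (simp add: space_restrict_space measure_restrict_space)
    \<comment> \<open>As \<open>w\<close> has mean zero on the line, the constant \<open>r x\<close>
      is the mean of \<open>?f\<close>, so \<open>w\<close> is almost everywhere \<open>?f\<close>
      minus its mean and the one-dimensional inequality applies.\<close>
    have "(\<integral>t. ?f t \<partial>interval_lebesgue) = (\<integral>t. w (set_coord x i t) + r x \<partial>interval_lebesgue)"
      using fw fm wm by (intro integral_cong_AE) auto
    also have "\<dots> = r x"
      using elim one by simp
    finally have mean: "(\<integral>t. ?f t \<partial>interval_lebesgue) = r x" .
    have "(\<integral>t. (w (set_coord x i t))\<^sup>2 \<partial>interval_lebesgue) = (\<integral>t. (?f t - r x)\<^sup>2 \<partial>interval_lebesgue)"
      using fw fm wm by (intro integral_cong_AE) auto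
    also have "\<dots> \<le> 1 / 2 * (\<integral>t. t * (1 - t) * (D (set_coord x i t))\<^sup>2 \<partial>interval_lebesgue)"
      using variance_le_weighted_derivative[OF deriv measurable_set_coord_section[OF Dm x] elim(4)]
      by (simp add: mean)
    finally show ?case .
  qed
  then have "(\<integral>x. \<integral>t. (w (set_coord x i t))\<^sup>2 \<partial>interval_lebesgue \<partial>cube_measure)
      \<le> (\<integral>x. 1 / 2 * (\<integral>t. t * (1 - t) * (D (set_coord x i t))\<^sup>2 \<partial>interval_lebesgue) \<partial>cube_measure)"
    using integrable_integral_set_coord[OF w2, of i] integrable_integral_set_coord[OF weighted, of i]
    by (intro integral_mono_AE) simp_all
  \<comment> \<open>Integrating over all lines restores the integrals over the cube; at the
    resampled point the \<open>i\<close>-th coordinate is \<open>t\<close>, so the line weight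
    \<open>t * (1 - t)\<close> becomes the weight in \<open>dgsm\<close>.\<close>
  then have "(\<integral>x. (w x)\<^sup>2 \<partial>cube_measure) \<le> dgsm i G"
    using integral_integral_set_coord[OF w2, of i] integral_integral_set_coord[OF weighted, of i]
    by (simp add: dgsm_def set_lebesgue_integral_cube D_def)
  moreover have "total_variance i G = (\<integral>x. (w x)\<^sup>2 \<partial>cube_measure)"
    unfolding w_def anova_sum_square(2)[OF anova]
    by (simp add: total_variance_def partial_variance_def set_lebesgue_integral_cube g_def)
  ultimately show ?thesis
    using assms(3) by (simp add: total_sobol_index_def divide_right_mono)
qed

end
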